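(* In the linear structural causal model, linear cost setting (with possibly immutable features) described in the context, the Linear Optimization algorithm described in the context computes the Pareto frontier of (improvement, risk) for linear mechanisms $f(x)=w^\top x$, using at most $2n$ deployments.
   Context: Model. Features $X\in\mathbb{R}^n$ and outcome $Y\in\mathbb{R}$ follow a linear structural causal model over a directed acyclic graph. Additive interventions $a\in\mathbb{R}^n$ on the features change them from $x$ to $x+Ba$, where $B\in\mathbb{R}^{n\times n}$ is an unknown full-rank matrix with all-ones diagonal (determined by the model); $Y$ cannot be directly intervened on and changes only through the features. $\mathcal{D}_0$ is the law of $(X,Y)$ without intervention. Best response. Facing $f(x)=w^\top x$, each individual maximizes $w^\top(x+Ba)$ over $a\in\mathbb{R}^n$ subject to $\sum_{i=1}^n c_i|a_i|\le b$. Feature $i$ is mutable if $c_i<\infty$ and immutable if $c_i=\infty$; $k\le n$ is the number of mutable features. The optimal intervention is $a^*(w)=\mathrm{sgn}((B^\top w)_{i^*})\frac{b}{c_{i^*}}e_{i^*}$, where $i^*=\arg\max_{j}|(B^\top w)_j|/c_j$ and $e_i$ is the $i$-th standard basis vector. If $(B^\top w)_j=0$ for all mutable $j$, the observed best response is an intervention on some mutable feature; no assumption is made on how this tie-breaking is done, except that it is done in the same way across individuals. A deployment is the release of one mechanism, after which the induced distribution of (features, outcome) is observed. Improvement, risk, Pareto frontier. Deploying $w$, with induced distribution $\mathcal{D}$, gives improvement $\mathbb{E}_{\mathcal{D}}[Y]-\mathbb{E}_{\mathcal{D}_0}[Y]$ (maximizing it is equivalent to maximizing $\mathbb{E}_{\mathcal{D}}[Y]$)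 and risk $R_{\mathcal{D}}(w)=\mathbb{E}_{\mathcal{D}}[(w^\top X-Y)^2]$. The Pareto frontier is the set of attainable (improvement, risk) pairs not dominated by another attainable pair (larger improvement and smaller risk being better). Linear Optimization algorithm. Deploy $f(x)=x_1$ and $f(x)=-x_1$, obtaining $\mathcal{D}_1,\mathcal{D}_{-1}$; set $\mathbb{E}_{\mathcal{D}_0}[X]=\frac12(\mathbb{E}_{\mathcal{D}_1}[X]+\mathbb{E}_{\mathcal{D}_{-1}}[X])$, $S=\{\mathcal{D}_1,\mathcal{D}_{-1}\}$, and let $W$ be the matrix with the single column $\mathbb{E}_{\mathcal{D}_1}[X]-\mathbb{E}_{\mathcal{D}_{-1}}[X]$. For $i=2,\dots,n$: compute some nonzero $w_i$ in the null space of $W^\top$ (using the SVD of $WW^\top$); deploy $f(x)=w_i^\top x$ and $f(x)=-w_i^\top x$ to obtain $\mathcal{D}_i,\mathcal{D}_{-i}$; if $\mathcal{D}_i\in S$, append the column $w_i$ to $W$; otherwise add $\mathcal{D}_i,\mathcal{D}_{-i}$ to $S$, append the column $\mathbb{E}_{\mathcal{D}_i}[X]-\mathbb{E}_{\mathcal{D}_0}[X]$ to $W$, and exit the loop if $|S|=2k$. Then, for each $\mathcal{D}_i\in S$, solve the quadratic program minimizing $R_{\mathcal{D}_i}(w)$ over $w$ subject to $w^\top(\mathbb{E}_{\mathcal{D}_i}[X]-\mathbb{E}_{\mathcal{D}_0}[X])\ge w^\top(\mathbb{E}_{\mathcal{D}_j}[X]-\mathbb{E}_{\mathcal{D}_0}[X])$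 for all $j\ne i$, with optimal value $R_i$, and record the pair $(\mathbb{E}_{\mathcal{D}_i}[Y],R_i)$. Return all recorded pairs that are not dominated by another recorded pair.
   Formalization: Tie-breaking is assumed to give opposite responses to w and -w for w nonzero, and a pair counts as attainable if any tied best response to w produces it; with arbitrary tie-breaking, or only the selected response counted, the claim is false. *)

theory Defs
  imports "HOL-Probability.Probability"
begin

section \<open>Linear structural causal models\<close>

text \<open>
  The nodes of the graph are \<open>'n option\<close>: \<open>Some i\<close> is the feature $X_i$ and \<open>None\<close> is the
  outcome $Y$.  \<open>A $ v $ u\<close> is the coefficient of the parent \<open>u\<close> in the structural equation of
  \<open>v\<close>, and \<open>N\<close> is the joint law of the exogenous variables.  Neither centred nor independent
  exogenous variables are required; finite second moments make the risk well defined.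
\<close>

definition linear_scm ::
  "('n::finite option) rel \<Rightarrow> real^('n option)^('n option) \<Rightarrow> (real^('n option)) measure \<Rightarrow> bool"
  where "linear_scm G A N \<longleftrightarrow>
    acyclic G \<and> (\<forall>v u. A $ v $ u \<noteq> 0 \<longrightarrow> (u, v) \<in> G) \<and>
    prob_space N \<and> sets N = sets borel \<and> (\<forall>v. integrable N (\<lambda>\<epsilon>. (\<epsilon> $ v)\<^sup>2))"

definition scm_solution ::
  "real^('n::finite option)^('n option) \<Rightarrow> real^('n option) \<Rightarrow> real^('n option)"
  where "scm_solution A \<epsilon> = (THE z. z = A *v z + \<epsilon>)"

definition features :: "real^('n::finite option) \<Rightarrow> real^'n"
  where "features z = (\<chi> i. z $ Some i)"

definition on_features :: "real^'n \<Rightarrow> real^('n::finite option)"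
  where "on_features a = (\<chi> v. case v of Some i \<Rightarrow> a $ i | None \<Rightarrow> 0)"

text \<open>The law of $(X, Y)$ when every individual carries out the additive intervention \<open>a\<close>.\<close>

definition law ::
  "real^('n::finite option)^('n option) \<Rightarrow> (real^('n option)) measure \<Rightarrow> real^'n
    \<Rightarrow> ((real^'n) \<times> real) measure"
  where "law A N a = distr N borel
    (\<lambda>\<epsilon>. let z = scm_solution A (\<epsilon> + on_features a) in (features z, z $ None))"

text \<open>The matrix $B$ of total effects: column \<open>j\<close> is the effect of a unit intervention on $X_j$.\<close>

definition effect_matrix :: "real^('n::finite option)^('n option) \<Rightarrow> real^'n^'n"
  where "effect_matrix A = (\<chi> i j. features (scm_solution A (on_features (axis j 1))) $ i)"

lemma dag_homogeneous_solution:
  fixes A :: "real^('n::finite option)^('n option)"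
  assumes "linear_scm G A N" "z = A *v z"
  shows "z = 0"
proof -
  have "wf G"
    using assms(1) by (auto simp: linear_scm_def intro: finite_acyclic_wf)
  then have "z $ v = 0" for v
  proof (induction v)
    case (less v)
    have "z $ v = (\<Sum>u\<in>UNIV. A $ v $ u * z $ u)"
      by (subst assms(2)) (simp add: matrix_vector_mult_def)
    also have "\<dots> = 0"
      using less assms(1) by (intro sum.neutral) (auto simp: linear_scm_def)
    finally show ?case .
  qed
  then show ?thesis by (simp add: vec_eq_iff)
qed

lemma scm_solution_ex1:
  assumes "linear_scm G A N"
  shows "\<exists>!z. z = A *v z + \<epsilon>"
proof -
  have eq: "z = A *v z + \<epsilon> \<longleftrightarrow> (mat 1 - A) *v z = \<epsilon>" for z
    by (auto simp: matrix_vector_mult_diff_rdistrib algebra_simps)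
  have "inj ((*v) (mat 1 - A))"
  proof (rule linear_injective_0[THEN iffD2, rule_format])
    fix z assume "(mat 1 - A) *v z = 0"
    then have "z = A *v z" by (simp add: matrix_vector_mult_diff_rdistrib)
    with assms show "z = 0" by (rule dag_homogeneous_solution)
  qed simp
  moreover from this have "surj ((*v) (mat 1 - A))"
    by (simp add: linear_injective_imp_surjective)
  ultimately show ?thesis
    unfolding eq by (metis injD surjD)
qed

lemma scm_solution:
  assumes "linear_scm G A N"
  shows "scm_solution A \<epsilon> = A *v scm_solution A \<epsilon> + \<epsilon>"
  unfolding scm_solution_def by (rule theI'[OF scm_solution_ex1[OF assms]])

lemma scm_solution_unique:
  assumes "linear_scm G A N" "z = A *v z + \<epsilon>"
  shows "scm_solution A \<epsilon> = z"
  using scm_solution_ex1[OF assms(1), of \<epsilon>] scm_solution[OF assms(1), of \<epsilon>] assms(2) by blast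

lemma linear_scm_solution:
  assumes "linear_scm G A N"
  shows "linear (scm_solution A)"
proof (rule linearI; rule scm_solution_unique[OF assms])
  fix x y :: "real^('a option)" and r :: real
  show "scm_solution A x + scm_solution A y =
      A *v (scm_solution A x + scm_solution A y) + (x + y)"
    by (subst (1) scm_solution[OF assms, of x], subst (1) scm_solution[OF assms, of y])
      (simp add: matrix_vector_right_distrib)
  show "r *\<^sub>R scm_solution A x = A *v (r *\<^sub>R scm_solution A x) + r *\<^sub>R x"
    using scm_solution[OF assms, of x]
    by (metis matrix_vector_mult_scaleR scaleR_right_distrib)
qed

lemma linear_features: "linear features"
  by (rule linearI) (auto simp: features_def vec_eq_iff)

lemma linear_on_features: "linear on_features"
  by (rule linearI) (auto simp: on_features_def vec_eq_iff split: option.splits)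

lemma effect_matrix_mult:
  assumes "linear_scm G A N"
  shows "effect_matrix A *v a = features (scm_solution A (on_features a))"
proof -
  let ?f = "\<lambda>a. features (scm_solution A (on_features a))"
  have "linear ?f"
    using linear_compose[OF linear_compose[OF linear_on_features linear_scm_solution[OF assms]]
      linear_features] by (simp add: o_def)
  moreover have "effect_matrix A = matrix ?f"
    by (simp add: effect_matrix_def matrix_def)
  ultimately show ?thesis by (simp add: matrix_works)
qed

text \<open>An intervention \<open>a\<close> changes the features from \<open>x\<close> to $x + B a$.\<close>

lemma features_intervention:
  assumes "linear_scm G A N"
  shows "features (scm_solution A (\<epsilon> + on_features a)) =
    features (scm_solution A \<epsilon>) + effect_matrix A *v a"
  by (simp add: effect_matrix_mult[OF assms] linear_add[OF linear_scm_solution[OF assms]]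
    linear_add[OF linear_features])

lemma invertible_effect_matrix:
  assumes "linear_scm G A N"
  shows "invertible (effect_matrix A)"
proof -
  have "a = 0" if "effect_matrix A *v a = 0" for a
  proof -
    define z where "z = scm_solution A (on_features a)"
    have z: "z = A *v z + on_features a"
      unfolding z_def by (rule scm_solution[OF assms])
    have feat: "z $ Some i = 0" for i
      using that unfolding effect_matrix_mult[OF assms] z_def[symmetric]
      by (simp add: features_def vec_eq_iff)
    have "(None, None) \<notin> G"
      using assms by (auto simp: linear_scm_def acyclic_def)
    then have "A $ None $ None = 0" using assms by (auto simp: linear_scm_def)
    then have "A $ None $ u * z $ u = 0" for u
      using feat by (cases u) auto
    then have "(\<Sum>u\<in>UNIV. A $ None $ u * z $ u) = 0" by (intro sum.neutral) blast
    then have "(A *v z) $ None = 0" by (simp add: matrix_vector_mult_def)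
    moreover have "z $ None = (A *v z) $ None + on_features a $ None"
      by (subst z) simp
    ultimately have "z $ None = 0" by (simp add: on_features_def)
    with feat have "z = 0"
      unfolding vec_eq_iff by (metis option.exhaust zero_index)
    with z have "on_features a = 0" by simp
    then have "on_features a $ Some i = 0" for i by simp
    then show "a = 0" by (simp add: on_features_def vec_eq_iff)
  qed
  then show ?thesis
    by (simp add: invertible_left_inverse matrix_left_invertible_ker)
qed

lemma effect_matrix_diagonal:
  assumes "linear_scm G A N"
  shows "effect_matrix A $ j $ j = 1"
proof -
  define z where "z = scm_solution A (on_features (axis j 1))"
  have z: "z = A *v z + on_features (axis j 1)"
    unfolding z_def by (rule scm_solution[OF assms])
  have z': "z $ v = (\<Sum>u\<in>UNIV. A $ v $ u * z $ u) + on_features (axis j 1) $ v" for v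
    by (subst z) (simp add: matrix_vector_mult_def)
  have "wf G"
    using assms by (auto simp: linear_scm_def intro: finite_acyclic_wf)
  then have desc: "z $ v \<noteq> 0 \<longrightarrow> (Some j, v) \<in> G\<^sup>*" for v
  proof (induction v)
    case (less v)
    show ?case
    proof (cases "v = Some j")
      case False
      then have "on_features (axis j 1) $ v = (0::real)"
        by (auto simp: on_features_def axis_def split: option.splits)
      show ?thesis
      proof
        assume "z $ v \<noteq> 0"
        then have "(\<Sum>u\<in>UNIV. A $ v $ u * z $ u) \<noteq> 0"
          using z'[of v] \<open>on_features (axis j 1) $ v = 0\<close> by simp
        then obtain u where "A $ v $ u * z $ u \<noteq> 0" by (meson sum.neutral)
        then have "(u, v) \<in> G" "z $ u \<noteq> 0"
          using assms by (auto simp: linear_scm_def)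
        then show "(Some j, v) \<in> G\<^sup>*" using less by (meson rtrancl.rtrancl_into_rtrancl)
      qed
    qed simp
  qed
  have "A $ Some j $ u * z $ u = 0" for u
  proof (rule ccontr)
    assume "A $ Some j $ u * z $ u \<noteq> 0"
    then have "(u, Some j) \<in> G" "(Some j, u) \<in> G\<^sup>*"
      using assms desc by (auto simp: linear_scm_def)
    then have "(Some j, Some j) \<in> G\<^sup>+" by (rule rtrancl_into_trancl1[rotated])
    then show False using assms by (auto simp: linear_scm_def acyclic_def)
  qed
  then have "(\<Sum>u\<in>UNIV. A $ Some j $ u * z $ u) = 0" by (intro sum.neutral) blast
  then have "z $ Some j = 1"
    using z'[of "Some j"] by (simp add: on_features_def axis_def)
  then show ?thesis by (simp add: effect_matrix_def features_def z_def)
qed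


section \<open>Best responses\<close>

text \<open>An infinite cost marks an immutable feature; in \<^typ>\<open>ennreal\<close> we have \<open>\<infinity> * 0 = 0\<close>.\<close>

definition within_budget :: "('n::finite \<Rightarrow> ennreal) \<Rightarrow> real \<Rightarrow> real^'n \<Rightarrow> bool"
  where "within_budget c b a \<longleftrightarrow> (\<Sum>i\<in>UNIV. c i * ennreal \<bar>a $ i\<bar>) \<le> ennreal b"

definition mutable :: "('n \<Rightarrow> ennreal) \<Rightarrow> 'n set"
  where "mutable c = {i. c i < \<infinity>}"

definition single_interventions :: "('n::finite \<Rightarrow> ennreal) \<Rightarrow> real \<Rightarrow> (real^'n) set"
  where "single_interventions c b =
    {axis i (s * (b / enn2real (c i))) | i s. i \<in> mutable c \<and> (s = 1 \<or> s = -1)}"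

text \<open>
  The optimal interventions that spend the budget on one mutable feature.  There are several of
  them if the maximum of $|(B^T w)_j| / c_j$ is attained more than once, and all interventions on
  a mutable feature qualify if $(B^T w)_j = 0$ for every mutable \<open>j\<close>.  The maximiser is the same
  for every individual \<open>x\<close>.  See \<open>best_responses_eq\<close> below for the closed form.
\<close>

definition best_responses ::
  "real^('n::finite option)^('n option) \<Rightarrow> ('n \<Rightarrow> ennreal) \<Rightarrow> real \<Rightarrow> real^'n \<Rightarrow> (real^'n) set"
  where "best_responses A c b w =
    {a \<in> single_interventions c b. within_budget c b a \<and>
      (\<forall>x a'. within_budget c b a' \<longrightarrow>
        w \<bullet> (x + effect_matrix A *v a') \<le> w \<bullet> (x + effect_matrix A *v a))}"

lemma sum_mult_axis: "(\<Sum>j\<in>UNIV. f j * ennreal \<bar>axis i x $ j\<bar>) = f i * ennreal \<bar>x\<bar>"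
proof -
  have "(\<Sum>j\<in>UNIV. f j * ennreal \<bar>axis i x $ j\<bar>) =
      (\<Sum>j\<in>UNIV. if j = i then f i * ennreal \<bar>x\<bar> else 0)"
    by (intro sum.cong) (auto simp: axis_def)
  then show ?thesis by simp
qed

lemma within_budget_finite_costs:
  assumes "\<And>i. 0 < c i" "within_budget c b a"
  shows "i \<notin> mutable c \<Longrightarrow> a $ i = 0"
    and "0 \<le> b \<Longrightarrow> (\<Sum>i\<in>mutable c. enn2real (c i) * \<bar>a $ i\<bar>) \<le> b"
proof -
  have le: "(\<Sum>i\<in>UNIV. c i * ennreal \<bar>a $ i\<bar>) \<le> ennreal b"
    using assms(2) by (simp add: within_budget_def)
  show zero: "a $ i = 0" if "i \<notin> mutable c" for i
  proof (rule ccontr)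
    assume "a $ i \<noteq> 0"
    moreover have "c i = \<infinity>" using that by (metis infinity_ennreal_def less_top mem_Collect_eq mutable_def)
    ultimately have "c i * ennreal \<bar>a $ i\<bar> = \<infinity>" by (simp add: ennreal_top_mult)
    moreover have "c i * ennreal \<bar>a $ i\<bar> \<le> (\<Sum>i\<in>UNIV. c i * ennreal \<bar>a $ i\<bar>)"
      by (rule member_le_sum) auto
    ultimately have "\<infinity> \<le> ennreal b" using le by (metis order_trans)
    then show False by (simp add: top_unique)
  qed
  assume "0 \<le> b"
  have "ennreal (\<Sum>i\<in>mutable c. enn2real (c i) * \<bar>a $ i\<bar>) =
      (\<Sum>i\<in>mutable c. c i * ennreal \<bar>a $ i\<bar>)"
    by (auto simp: sum_ennreal[symmetric] ennreal_mult mutable_def intro!: sum.cong)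
  also have "\<dots> = (\<Sum>i\<in>UNIV. c i * ennreal \<bar>a $ i\<bar>)"
    by (intro sum.mono_neutral_left) (auto simp: zero)
  also note le
  finally show "(\<Sum>i\<in>mutable c. enn2real (c i) * \<bar>a $ i\<bar>) \<le> b"
    using \<open>0 \<le> b\<close> by simp
qed

lemma best_responses_eq:
  fixes A :: "real^('n::finite option)^('n option)"
  assumes c: "\<And>i. 0 < c i" and b: "0 < b"
  defines "v \<equiv> \<lambda>w. transpose (effect_matrix A) *v w"
  shows "best_responses A c b w =
    {axis i (s * (b / enn2real (c i))) | i s. i \<in> mutable c \<and>
      (\<forall>j\<in>mutable c. \<bar>v w $ j\<bar> / enn2real (c j) \<le> \<bar>v w $ i\<bar> / enn2real (c i)) \<and>
      (if v w $ i = 0 then s = 1 \<or> s = -1 else s = sgn (v w $ i))}"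
    (is "_ = ?R")
proof -
  let ?c = "\<lambda>i. enn2real (c i)"
  have cpos: "?c i > 0" if "i \<in> mutable c" for i
    using that c[of i] by (simp add: mutable_def enn2real_positive_iff)
  have inner: "w \<bullet> (effect_matrix A *v a) = v w \<bullet> a" for a
    by (simp add: v_def dot_lmul_matrix transpose_matrix_vector)
  have inner_axis': "v w \<bullet> axis i x = v w $ i * x" for i x
    by (simp add: inner_axis)
  have feasible: "within_budget c b (axis i (s * (b / ?c i)))"
    if "i \<in> mutable c" "s = 1 \<or> s = -1" for i s
  proof -
    have "c i * ennreal \<bar>s * (b / ?c i)\<bar> = ennreal (?c i) * ennreal (b / ?c i)"
      using that b cpos[OF that(1)] by (auto simp: mutable_def)
    also have "\<dots> = ennreal b"
      using b cpos[OF that(1)] by (simp add: ennreal_mult[symmetric])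
    finally show ?thesis by (simp add: within_budget_def sum_mult_axis)
  qed
  have BR: "best_responses A c b w = {a \<in> single_interventions c b.
      \<forall>a'. within_budget c b a' \<longrightarrow> v w \<bullet> a' \<le> v w \<bullet> a}"
    using feasible by (auto simp: best_responses_def inner_add_right inner single_interventions_def)
  show ?thesis
  proof (intro subset_antisym subsetI)
    fix a assume "a \<in> best_responses A c b w"
    then obtain i s where i: "i \<in> mutable c" and s: "s = 1 \<or> s = -1"
      and a: "a = axis i (s * (b / ?c i))"
      and opt: "\<And>a'. within_budget c b a' \<Longrightarrow> v w \<bullet> a' \<le> v w \<bullet> a"
      unfolding BR single_interventions_def by blast
    have le: "v w $ j * (t * (b / ?c j)) \<le> v w $ i * (s * (b / ?c i))"
      if "j \<in> mutable c" "t = 1 \<or> t = -1" for j t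
      using opt[OF feasible[OF that]] by (simp add: a inner_axis')
    have abs: "\<bar>v w $ j\<bar> * (b / ?c j) \<le> v w $ i * (s * (b / ?c i))" if "j \<in> mutable c" for j
      using le[OF that, of 1] le[OF that, of "-1"] by (auto simp: abs_if)
    have absi: "\<bar>v w $ i\<bar> \<le> v w $ i * s"
      using abs[OF i] b cpos[OF i] by (simp add: field_simps)
    have sle: "v w $ i * s \<le> \<bar>v w $ i\<bar>" using s by auto
    have "\<bar>v w $ j\<bar> / ?c j \<le> \<bar>v w $ i\<bar> / ?c i" if j: "j \<in> mutable c" for j
    proof -
      have "b * (\<bar>v w $ j\<bar> / ?c j) \<le> (v w $ i * s) * (b / ?c i)"
        using abs[OF j] by (simp add: mult_ac)
      also have "\<dots> \<le> \<bar>v w $ i\<bar> * (b / ?c i)"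
        using sle b cpos[OF i] by (intro mult_right_mono) auto
      finally have "b * (\<bar>v w $ j\<bar> / ?c j) \<le> b * (\<bar>v w $ i\<bar> / ?c i)" by (simp add: mult_ac)
      then show ?thesis using b by (simp only: mult_le_cancel_left_pos)
    qed
    moreover have "if v w $ i = 0 then s = 1 \<or> s = -1 else s = sgn (v w $ i)"
      using s absi by (auto simp: sgn_if split: if_splits)
    ultimately show "a \<in> ?R" using i a by blast
  next
    fix a assume "a \<in> ?R"
    then obtain i s where i: "i \<in> mutable c" and a: "a = axis i (s * (b / ?c i))"
      and max: "\<And>j. j \<in> mutable c \<Longrightarrow> \<bar>v w $ j\<bar> / ?c j \<le> \<bar>v w $ i\<bar> / ?c i"
      and s': "if v w $ i = 0 then s = 1 \<or> s = -1 else s = sgn (v w $ i)" by blast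
    have s: "s = 1 \<or> s = -1" and vs: "v w $ i * s = \<bar>v w $ i\<bar>"
      using s' by (auto simp: sgn_if split: if_splits)
    have "v w \<bullet> a' \<le> v w \<bullet> a" if a': "within_budget c b a'" for a'
    proof -
      have "v w \<bullet> a' = (\<Sum>j\<in>UNIV. v w $ j * a' $ j)" by (simp add: inner_vec_def)
      also have "\<dots> = (\<Sum>j\<in>mutable c. v w $ j * a' $ j)"
        using within_budget_finite_costs(1)[OF c a'] by (intro sum.mono_neutral_right) auto
      also have "\<dots> \<le> (\<Sum>j\<in>mutable c. \<bar>v w $ i\<bar> / ?c i * (?c j * \<bar>a' $ j\<bar>))"
      proof (rule sum_mono)
        fix j assume j: "j \<in> mutable c"
        have "v w $ j * a' $ j \<le> (\<bar>v w $ j\<bar> / ?c j) * (?c j * \<bar>a' $ j\<bar>)"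
          using cpos[OF j] by (simp flip: abs_mult)
        also have "\<dots> \<le> \<bar>v w $ i\<bar> / ?c i * (?c j * \<bar>a' $ j\<bar>)"
          using max[OF j] by (intro mult_right_mono) auto
        finally show "v w $ j * a' $ j \<le> \<bar>v w $ i\<bar> / ?c i * (?c j * \<bar>a' $ j\<bar>)" .
      qed
      also have "\<dots> = \<bar>v w $ i\<bar> / ?c i * (\<Sum>j\<in>mutable c. ?c j * \<bar>a' $ j\<bar>)"
        by (simp add: sum_distrib_left)
      also have "\<dots> \<le> \<bar>v w $ i\<bar> / ?c i * b"
        using within_budget_finite_costs(2)[OF c a'] b by (intro mult_left_mono) auto
      also have "\<dots> = v w \<bullet> a" by (simp add: a inner_axis' vs[symmetric])
      finally show ?thesis .
    qed
    then show "a \<in> best_responses A c b w"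
      unfolding BR single_interventions_def using i s a by blast
  qed
qed


section \<open>Improvement, risk, Pareto frontier\<close>

definition mean_features :: "((real^'n::finite) \<times> real) measure \<Rightarrow> real^'n"
  where "mean_features D = (LINT p|D. fst p)"

definition mean_outcome :: "((real^'n::finite) \<times> real) measure \<Rightarrow> real"
  where "mean_outcome D = (LINT p|D. snd p)"

definition risk :: "((real^'n::finite) \<times> real) measure \<Rightarrow> real^'n \<Rightarrow> real"
  where "risk D w = (LINT p|D. (w \<bullet> fst p - snd p)\<^sup>2)"

definition dominates :: "real \<times> real \<Rightarrow> real \<times> real \<Rightarrow> bool"
  where "dominates q p \<longleftrightarrow> fst q \<ge> fst p \<and> snd q \<le> snd p \<and> q \<noteq> p"

definition nondominated :: "(real \<times> real) set \<Rightarrow> (real \<times> real) set"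
  where "nondominated P = {p \<in> P. \<not> (\<exists>q\<in>P. dominates q p)}"

text \<open>
  If \<open>w\<close> has several best responses, each of them yields an attainable pair.  With one fixed
  tie-breaking rule an optimum on a tie (such as \<open>w = 0\<close>) need not be attained.
\<close>

definition attainable ::
  "real^('n::finite option)^('n option) \<Rightarrow> (real^('n option)) measure \<Rightarrow> ('n \<Rightarrow> ennreal) \<Rightarrow> real
    \<Rightarrow> (real \<times> real) set"
  where "attainable A N c b =
    {(mean_outcome (law A N a) - mean_outcome (law A N 0), risk (law A N a) w) | w a.
      a \<in> best_responses A c b w}"

definition pareto_frontier ::
  "real^('n::finite option)^('n option) \<Rightarrow> (real^('n option)) measure \<Rightarrow> ('n \<Rightarrow> ennreal) \<Rightarrow> real
    \<Rightarrow> (real \<times> real) set"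
  where "pareto_frontier A N c b = nondominated (attainable A N c b)"

text \<open>
  A response rule fixes how ties are broken, in the same way for all individuals.  Opposite
  mechanisms have opposite best responses; the rule has to respect this on ties as well, as the
  algorithm takes the mean of \<open>deploy w\<close> and \<open>deploy (- w)\<close> for the mean without intervention.
  At \<open>w = 0\<close> the choice is free.
\<close>

definition response_rule ::
  "real^('n::finite option)^('n option) \<Rightarrow> ('n \<Rightarrow> ennreal) \<Rightarrow> real \<Rightarrow> (real^'n \<Rightarrow> real^'n) \<Rightarrow> bool"
  where "response_rule A c b respond \<longleftrightarrow>
    (\<forall>w. respond w \<in> best_responses A c b w) \<and>
    (\<forall>w. w \<noteq> 0 \<longrightarrow> respond (- w) = - respond w)"


section \<open>The algorithm\<close>

text \<open>
  The matrix $W$ is the list of its columns.  The algorithm accesses the model only through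
  \<open>deploy\<close>, which maps a mechanism to the induced law of $(X, Y)$.
\<close>

definition null_space_transpose :: "(real^'n::finite) list \<Rightarrow> (real^'n) set"
  where "null_space_transpose W = {w. \<forall>v\<in>set W. v \<bullet> w = 0}"

definition null_vector_routine :: "((real^'n::finite) list \<Rightarrow> real^'n) \<Rightarrow> bool"
  where "null_vector_routine null_vec \<longleftrightarrow>
    (\<forall>W. (\<exists>w\<in>null_space_transpose W. w \<noteq> 0) \<longrightarrow>
      null_vec W \<in> null_space_transpose W \<and> null_vec W \<noteq> 0)"

text \<open>The state consists of $S$, of $W$ and of the mechanisms deployed so far.\<close>

type_synonym 'n lo_state =
  "((real^'n) \<times> real) measure set \<times> (real^'n) list \<times> (real^'n) list"

fun lo_loop ::
  "(real^'n::finite \<Rightarrow> ((real^'n) \<times> real) measure) \<Rightarrow> ((real^'n) list \<Rightarrow> real^'n) \<Rightarrow> nat \<Rightarrow> real^'n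
    \<Rightarrow> nat \<Rightarrow> 'n lo_state \<Rightarrow> 'n lo_state"
  where
    "lo_loop deploy null_vec k \<mu>\<^sub>0 0 (S, W, deployed) = (S, W, deployed)"
  | "lo_loop deploy null_vec k \<mu>\<^sub>0 (Suc m) (S, W, deployed) =
      (let w = null_vec W;
           D = deploy w;
           D' = deploy (- w);
           deployed' = deployed @ [w, - w]
       in if D \<in> S then lo_loop deploy null_vec k \<mu>\<^sub>0 m (S, W @ [w], deployed')
          else let S' = S \<union> {D, D'};
                   W' = W @ [mean_features D - \<mu>\<^sub>0]
               in if card S' = 2 * k then (S', W', deployed')
                  else lo_loop deploy null_vec k \<mu>\<^sub>0 m (S', W', deployed'))"

definition qp_value ::
  "real^'n::finite \<Rightarrow> ((real^'n) \<times> real) measure set \<Rightarrow> ((real^'n) \<times> real) measure \<Rightarrow> real"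
  where "qp_value \<mu>\<^sub>0 S D =
    (INF w \<in> {w. \<forall>D' \<in> S - {D}.
        w \<bullet> (mean_features D - \<mu>\<^sub>0) \<ge> w \<bullet> (mean_features D' - \<mu>\<^sub>0)}. risk D w)"

text \<open>Returns the nondominated recorded pairs and the list of deployed mechanisms.\<close>

definition linear_optimization ::
  "(real^'n::finite \<Rightarrow> ((real^'n) \<times> real) measure) \<Rightarrow> ((real^'n) list \<Rightarrow> real^'n) \<Rightarrow> nat \<Rightarrow> 'n
    \<Rightarrow> (real \<times> real) set \<times> (real^'n) list"
  where "linear_optimization deploy null_vec k first =
    (let e = axis first 1;
         D\<^sub>1 = deploy e;
         D\<^sub>m\<^sub>1 = deploy (- e);
         \<mu>\<^sub>0 = (1/2) *\<^sub>R (mean_features D\<^sub>1 + mean_features D\<^sub>m\<^sub>1);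
         (S, W, deployed) = lo_loop deploy null_vec k \<mu>\<^sub>0 (CARD('n) - 1)
           ({D\<^sub>1, D\<^sub>m\<^sub>1}, [mean_features D\<^sub>1 - mean_features D\<^sub>m\<^sub>1], [e, - e])
     in (nondominated {(mean_outcome D, qp_value \<mu>\<^sub>0 S D) | D. D \<in> S}, deployed))"

end

theory Submission
  imports Defs
begin

text \<open>
  Mechanisms that induce the same response \<open>a\<close> form a polyhedral cone, cut out by comparing \<open>a\<close>
  with the other interventions on a single mutable feature.  Improvement is constant on this cone,
  so the frontier consists of the nondominated pairs of improvement and least risk, provided that
  the least risk is attained.  It is: the risk factors through a linear projection on whose range
  it is coercive, and the projection of a polyhedral cone is closed.

  The algorithm sees every one of these responses: a null vector \<open>w\<close> of \<open>W\<^sup>T\<close> whose response is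
  already known has $(B^T w)_j = 0$ for every mutable \<open>j\<close>, and at most \<open>n - k\<close> such vectors are
  pairwise orthogonal.
\<close>

section \<open>Attainment of least squares on polyhedral cones\<close>

text \<open>Linear images of closed cones can fail to be closed. Here \<open>C\<close> is generated
  by the polytope \<open>T\<close> that a box around the origin cuts out of it, so its image is
  generated by the image of \<open>T\<close>, again a polytope, and the conic hull of a polytope is
  closed.\<close>

lemma closed_linear_image_polyhedral_cone:
  fixes f :: "'a::euclidean_space \<Rightarrow> 'b::euclidean_space"
  assumes "linear f" "polyhedron C" "conic C"
  shows "closed (f ` C)"
proof -
  define T where "T = cbox (-One) One \<inter> C"
  have "polytope T"
    unfolding T_def by (intro polytope_Int_polyhedron assms polytope_interval)
  have "conic hull T = C"
  proof (rule hull_unique)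
    show "T \<subseteq> C" by (simp add: T_def)
    show "conic C" by fact
    fix K assume K: "T \<subseteq> K" "conic K"
    show "C \<subseteq> K"
    proof
      fix x assume x: "x \<in> C"
      \<comment> \<open>The summand 1 keeps the factor positive when \<open>x = 0\<close>; dividing
        by \<open>r\<close> brings every coordinate into the box.\<close>
      define r where "r = norm x + 1"
      have r: "r > 0" by (simp add: r_def add_nonneg_pos)
      have "- r \<le> x \<bullet> i \<and> x \<bullet> i \<le> r" if "i \<in> Basis" for i
        using Basis_le_norm[OF that, of x] by (auto simp: r_def abs_le_iff)
      then have "inverse r *\<^sub>R x \<in> cbox (-One) One"
        using r by (auto simp: mem_box field_simps)
      then have "inverse r *\<^sub>R x \<in> K"
        using x r K(1) conicD[OF assms(3) x, of "inverse r"] by (auto simp: T_def)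
      from conicD[OF K(2) this, of r] show "x \<in> K" using r by simp
    qed
  qed
  then have "f ` C = conic hull (f ` T)"
    by (simp add: conic_hull_linear_image[OF assms(1)])
  then show ?thesis
    using closed_conic_hull_strong[of "f ` T"] polytope_linear_image[OF assms(1) \<open>polytope T\<close>] by simp
qed

text \<open>The second moment form may be degenerate, so sublevel sets need not be bounded.
  Directions \<open>w\<close> with \<open>w \<bullet> X x = 0\<close> almost everywhere leave the
  objective unchanged; a projection \<open>P\<close> with exactly this kernel moves the problem to
  the image of \<open>C\<close>, which is closed and on which the objective is coercive.\<close>

lemma least_squares_attained:
  fixes X :: "'b \<Rightarrow> 'a::euclidean_space" and Y :: "'b \<Rightarrow> real"
  assumes [measurable]: "X \<in> borel_measurable M" "Y \<in> borel_measurable M"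
    and X2: "integrable M (\<lambda>x. (norm (X x))\<^sup>2)" and Y2: "integrable M (\<lambda>x. (Y x)\<^sup>2)"
    and C: "polyhedron C" "conic C" "C \<noteq> {}"
  obtains w where "w \<in> C"
    "\<And>w'. w' \<in> C \<Longrightarrow> (LINT x|M. (w \<bullet> X x - Y x)\<^sup>2) \<le> (LINT x|M. (w' \<bullet> X x - Y x)\<^sup>2)"
proof -
  define Q where "Q w = (LINT x|M. (w \<bullet> X x - Y x)\<^sup>2)" for w
  \<comment> \<open>\<open>f\<close> applies the second moment matrix of \<open>X\<close>,
    \<open>q\<close> is the cross moment of \<open>X\<close> and \<open>Y\<close>, and
    \<open>r\<close> the second moment of \<open>Y\<close>: the coefficients of the quadratic
    polynomial \<open>Q\<close>.\<close>
  define f where "f w = (LINT x|M. (w \<bullet> X x) *\<^sub>R X x)" for w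
  define q where "q = (LINT x|M. Y x *\<^sub>R X x)"
  define r where "r = (LINT x|M. (Y x)\<^sup>2)"
  have intf: "integrable M (\<lambda>x. (w \<bullet> X x) *\<^sub>R X x)" for w
  proof (rule Bochner_Integration.integrable_bound)
    show "integrable M (\<lambda>x. norm w * (norm (X x))\<^sup>2)" using X2 by simp
    have "\<bar>w \<bullet> X x\<bar> * norm (X x) \<le> norm w * norm (X x) * norm (X x)" for x
      by (intro mult_right_mono Cauchy_Schwarz_ineq2) auto
    then show "AE x in M. norm ((w \<bullet> X x) *\<^sub>R X x) \<le> norm (norm w * (norm (X x))\<^sup>2)"
      by (simp add: power2_eq_square mult.assoc)
  qed measurable
  have intq: "integrable M (\<lambda>x. Y x *\<^sub>R X x)"
  proof (rule Bochner_Integration.integrable_bound)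
    show "integrable M (\<lambda>x. (Y x)\<^sup>2 + (norm (X x))\<^sup>2)" using X2 Y2 by simp
    have "\<bar>Y x\<bar> * norm (X x) \<le> (Y x)\<^sup>2 + (norm (X x))\<^sup>2" for x
    proof -
      have "\<bar>Y x\<bar> * norm (X x) \<le> 2 * \<bar>Y x\<bar> * norm (X x)" by simp
      also have "\<dots> \<le> \<bar>Y x\<bar>\<^sup>2 + (norm (X x))\<^sup>2" by (rule sum_squares_bound)
      finally show ?thesis by simp
    qed
    then show "AE x in M. norm (Y x *\<^sub>R X x) \<le> norm ((Y x)\<^sup>2 + (norm (X x))\<^sup>2)"
      by simp
  qed measurable
  have f: "linear f"
    by (rule linearI) (simp_all add: f_def inner_add_left scaleR_add_left intf flip: scaleR_scaleR)
  have wfw: "v \<bullet> f w = (LINT x|M. (v \<bullet> X x) * (w \<bullet> X x))"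
    and intwfw: "integrable M (\<lambda>x. (v \<bullet> X x) * (w \<bullet> X x))" for v w
    using integral_inner_right[of v M "\<lambda>x. (w \<bullet> X x) *\<^sub>R X x"]
      integrable_inner_right[of v M "\<lambda>x. (w \<bullet> X x) *\<^sub>R X x"] intf[of w]
    by (simp_all add: f_def mult.commute)
  have wq: "w \<bullet> q = (LINT x|M. Y x * (w \<bullet> X x))"
    and intwq: "integrable M (\<lambda>x. Y x * (w \<bullet> X x))" for w
    using integral_inner_right[of w M "\<lambda>x. Y x *\<^sub>R X x"]
      integrable_inner_right[of w M "\<lambda>x. Y x *\<^sub>R X x"] intq
    by (simp_all add: q_def)
  have sq: "(w \<bullet> X x - Y x)\<^sup>2 = (w \<bullet> X x) * (w \<bullet> X x) - 2 * (Y x * (w \<bullet> X x)) + (Y x)\<^sup>2" for w x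
    by (simp add: power2_eq_square algebra_simps)
  have Q_eq: "Q w = w \<bullet> f w - 2 * (w \<bullet> q) + r" for w
    unfolding Q_def sq wfw wq r_def using intwfw[of w w] intwq[of w] Y2 by simp
  have intQ: "integrable M (\<lambda>x. (w \<bullet> X x - Y x)\<^sup>2)" for w
    unfolding sq using intwfw[of w w] intwq[of w] Y2 by simp
  \<comment> \<open>With s = \<open>w \<bullet> X x\<close> and y = \<open>Y x\<close>, the
    pointwise bound (s - y)^2 \<ge> s^2/2 - y^2 is half of (s - 2y)^2 \<ge> 0.\<close>
  have Q_ge: "Q w \<ge> w \<bullet> f w / 2 - r" for w
  proof -
    have "(LINT x|M. (w \<bullet> X x) * (w \<bullet> X x) / 2 - (Y x)\<^sup>2) \<le> Q w"
      unfolding Q_def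
    proof (rule integral_mono)
      show "(w \<bullet> X x) * (w \<bullet> X x) / 2 - (Y x)\<^sup>2 \<le> (w \<bullet> X x - Y x)\<^sup>2" for x
        using zero_le_power2[of "w \<bullet> X x - 2 * Y x"]
        by (simp add: power2_eq_square field_simps)
    qed (use intwfw[of w w] Y2 intQ in simp_all)
    then show ?thesis using intwfw[of w w] Y2 by (simp add: wfw r_def)
  qed
  have fpos: "w \<bullet> f w \<ge> 0" for w
    unfolding wfw by (rule integral_nonneg_AE) simp
  have fker: "AE x in M. w \<bullet> X x = 0" if "w \<bullet> f w = 0" for w
  proof -
    have "AE x in M. (w \<bullet> X x) * (w \<bullet> X x) = 0"
      using that integral_nonneg_eq_0_iff_AE[OF intwfw[of w w]] by (simp add: wfw)
    then show ?thesis by simp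
  qed
  \<comment> \<open>\<open>g\<close> is a generalized inverse of \<open>f\<close>, so
    \<open>g \<circ> f\<close> is idempotent with the same kernel as \<open>f\<close>.\<close>
  obtain g where g: "linear g" "\<And>w. f (g (f w)) = f w"
    using linear_exists_right_inverse_on[OF f subspace_UNIV] by auto
  define P where "P = g \<circ> f"
  have P: "linear P" unfolding P_def using f g(1) by (rule linear_compose)
  have QP: "Q (P w) = Q w" for w
  proof -
    have "f (P w - w) = 0" using g(2)[of w] by (simp add: P_def linear_diff[OF f])
    then have "AE x in M. (P w - w) \<bullet> X x = 0" using fker by simp
    then have "AE x in M. (P w \<bullet> X x - Y x)\<^sup>2 = (w \<bullet> X x - Y x)\<^sup>2"
      by eventually_elim (simp add: inner_diff_left)
    then show ?thesis unfolding Q_def by (intro integral_cong_AE) auto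
  qed
  have Pdef: "u = 0" if "u \<in> range P" "u \<bullet> f u = 0" for u
  proof -
    obtain w where w: "u = g (f w)" using \<open>u \<in> range P\<close> by (auto simp: P_def)
    have "AE x in M. (u \<bullet> X x) *\<^sub>R X x = 0" using fker[OF that(2)] by eventually_elim simp
    then have "f u = 0" unfolding f_def by (rule integral_eq_zero_AE)
    then show "u = 0" using g(2)[of w] w linear_0[OF g(1)] by simp
  qed
  have cont_f: "continuous_on S f" for S
    using f by (rule linear_continuous_on[OF linear_conv_bounded_linear[THEN iffD1]])
  \<comment> \<open>Coercivity on the range: \<open>m\<close> is the minimum of the form over the
    unit sphere of \<open>range P\<close>. If that sphere is empty, the range is trivial and
    \<open>m = 1\<close> serves.\<close>
  obtain m where m: "m > 0" "\<And>u. u \<in> range P \<Longrightarrow> u \<bullet> f u \<ge> m * (norm u)\<^sup>2"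
  proof (cases "range P \<inter> sphere 0 1 = {}")
    case True
    have "u = 0" if "u \<in> range P" for u
    proof (rule ccontr)
      assume "u \<noteq> 0"
      moreover from this have "inverse (norm u) *\<^sub>R u \<in> sphere 0 1" by simp
      moreover have "inverse (norm u) *\<^sub>R u \<in> range P"
        using that linear_subspace_image[OF P subspace_UNIV] by (simp add: subspace_scale)
      ultimately show False using True by blast
    qed
    then have "\<And>u. u \<in> range P \<Longrightarrow> 1 * (norm u)\<^sup>2 \<le> u \<bullet> f u" using fpos by fastforce
    then show ?thesis using that[of 1] by simp
  next
    case False
    have "compact (range P \<inter> sphere 0 1)"
      using linear_subspace_image[OF P subspace_UNIV] by (intro closed_Int_compact closed_subspace) auto
    moreover have "continuous_on (range P \<inter> sphere 0 1) (\<lambda>u. u \<bullet> f u)"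
      using cont_f by (intro continuous_intros)
    ultimately obtain u0 where u0: "u0 \<in> range P \<inter> sphere 0 1"
      "\<And>u. u \<in> range P \<inter> sphere 0 1 \<Longrightarrow> u0 \<bullet> f u0 \<le> u \<bullet> f u"
      using continuous_attains_inf[OF _ False, of "\<lambda>u. u \<bullet> f u"] by blast
    have "u0 \<noteq> 0" using u0(1) by auto
    then have pos: "u0 \<bullet> f u0 > 0" using Pdef[of u0] u0(1) fpos[of u0] by (auto simp: less_le)
    have "u \<bullet> f u \<ge> (u0 \<bullet> f u0) * (norm u)\<^sup>2" if "u \<in> range P" for u
    proof (cases "u = 0")
      case nz: False
      have "inverse (norm u) *\<^sub>R u \<in> range P \<inter> sphere 0 1"
        using that linear_subspace_image[OF P subspace_UNIV] nz by (simp add: subspace_scale)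
      from u0(2)[OF this] have "u0 \<bullet> f u0 \<le> (u \<bullet> f u) / (norm u)\<^sup>2"
        by (simp add: linear_scale[OF f] power2_eq_square divide_inverse mult_ac)
      then show ?thesis using nz by (simp add: field_simps)
    qed (use fpos in simp)
    with pos show ?thesis using that by blast
  qed
  have closed: "closed (P ` C)" by (rule closed_linear_image_polyhedral_cone[OF P C(1,2)])
  obtain c0 where c0: "c0 \<in> C" using C(3) by auto
  \<comment> \<open>The radius comes from solving m |u|^2 / 2 - r \<le> \<open>Q c0\<close> for |u|;
    this inequality combines \<open>Q_ge\<close> with coercivity.\<close>
  define R where "R = sqrt (2 * (Q c0 + r) / m)"
  have bound: "norm u \<le> R" if "u \<in> P ` C" "Q u \<le> Q c0" for u
  proof -
    have "m * (norm u)\<^sup>2 / 2 - r \<le> Q c0"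
      using m(2)[of u] that Q_ge[of u] by auto
    then have "(norm u)\<^sup>2 \<le> 2 * (Q c0 + r) / m" using m(1) by (simp add: field_simps)
    then show ?thesis unfolding R_def by (rule real_le_rsqrt)
  qed
  have "compact (P ` C \<inter> cball 0 R)" using closed by (intro closed_Int_compact) auto
  moreover have Pc0: "P c0 \<in> P ` C \<inter> cball 0 R" using c0 bound[of "P c0"] QP[of c0] by auto
  moreover have "continuous_on (P ` C \<inter> cball 0 R) Q"
    unfolding Q_eq using cont_f by (intro continuous_intros)
  ultimately obtain u where u: "u \<in> P ` C \<inter> cball 0 R"
    "\<And>u'. u' \<in> P ` C \<inter> cball 0 R \<Longrightarrow> Q u \<le> Q u'"
    using continuous_attains_inf[of "P ` C \<inter> cball 0 R" Q] by blast
  obtain w where w: "w \<in> C" "u = P w" using u(1) by auto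
  \<comment> \<open>\<open>P\<close> need not map \<open>C\<close> into itself, but \<open>Q\<close>
    is invariant under it, so a preimage in \<open>C\<close> of the minimiser \<open>u\<close> is
    optimal. A competitor worse than \<open>c0\<close> is covered by comparing \<open>u\<close> with
    \<open>P c0\<close>.\<close>
  have "Q w \<le> Q w'" if "w' \<in> C" for w'
  proof (cases "Q w' \<le> Q c0")
    case True
    then show ?thesis using u(2)[of "P w'"] bound[of "P w'"] that QP w by auto
  next
    case False
    then show ?thesis using u(2)[OF Pc0] QP w by simp
  qed
  then show thesis using that[OF w(1)] by (simp add: Q_def)
qed

section \<open>Moments of the induced laws\<close>

lemma linear_scm_integrable:
  assumes "linear_scm G A N"
  shows "integrable N (\<lambda>\<epsilon>. (l \<bullet> \<epsilon> + d)\<^sup>2)" "integrable N (\<lambda>\<epsilon>. \<epsilon>)"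
proof -
  interpret prob_space N using assms by (simp add: linear_scm_def)
  have sets [measurable_cong]: "sets N = sets borel" using assms by (simp add: linear_scm_def)
  have sq: "integrable N (\<lambda>\<epsilon>. (\<epsilon> $ v)\<^sup>2)" for v using assms by (simp add: linear_scm_def)
  have prod: "integrable N (\<lambda>\<epsilon>. \<epsilon> $ u * \<epsilon> $ v)" for u v
  proof (rule Bochner_Integration.integrable_bound)
    show "integrable N (\<lambda>\<epsilon>. (\<epsilon> $ u)\<^sup>2 + (\<epsilon> $ v)\<^sup>2)" using sq by simp
    have "\<bar>x * y\<bar> \<le> x\<^sup>2 + y\<^sup>2" for x y :: real
    proof -
      have "\<bar>x * y\<bar> \<le> 2 * \<bar>x\<bar> * \<bar>y\<bar>" by (simp add: abs_mult)
      also have "\<dots> \<le> x\<^sup>2 + y\<^sup>2" using sum_squares_bound[of "\<bar>x\<bar>" "\<bar>y\<bar>"] by simp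
      finally show ?thesis .
    qed
    then show "AE \<epsilon> in N. norm (\<epsilon> $ u * \<epsilon> $ v) \<le> norm ((\<epsilon> $ u)\<^sup>2 + (\<epsilon> $ v)\<^sup>2)" by simp
  qed simp
  have comp: "integrable N (\<lambda>\<epsilon>. \<epsilon> $ v)" for v
    by (rule square_integrable_imp_integrable[OF _ sq]) simp
  have "integrable N (\<lambda>\<epsilon>. \<Sum>v\<in>UNIV. (\<epsilon> $ v) *\<^sub>R axis v (1::real))"
    by (intro Bochner_Integration.integrable_sum integrable_scaleR_left comp)
  moreover have "(\<Sum>v\<in>UNIV. (\<epsilon> $ v) *\<^sub>R axis v (1::real)) = \<epsilon>" for \<epsilon> :: "real^('a option)"
    using basis_expansion[of \<epsilon>] by (simp add: scalar_mult_eq_scaleR)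
  ultimately show int: "integrable N (\<lambda>\<epsilon>. \<epsilon>)" by simp
  have "integrable N (\<lambda>\<epsilon>. (\<Sum>u\<in>UNIV. \<Sum>v\<in>UNIV. (l $ u * l $ v) * (\<epsilon> $ u * \<epsilon> $ v)) + 2 * d * (l \<bullet> \<epsilon>) + d\<^sup>2)"
    by (intro Bochner_Integration.integrable_add Bochner_Integration.integrable_sum
        integrable_mult_right prod integrable_inner_right int integrable_const)
  moreover have "(\<Sum>u\<in>UNIV. \<Sum>v\<in>UNIV. (l $ u * l $ v) * (\<epsilon> $ u * \<epsilon> $ v)) = (l \<bullet> \<epsilon>) * (l \<bullet> \<epsilon>)" for \<epsilon>
    by (simp add: inner_vec_def sum_product mult_ac)
  ultimately show "integrable N (\<lambda>\<epsilon>. (l \<bullet> \<epsilon> + d)\<^sup>2)"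
    by (simp add: power2_eq_square algebra_simps)
qed

lemma borel_measurable_response:
  assumes "linear_scm G A N"
  shows "(\<lambda>\<epsilon>. let z = scm_solution A (\<epsilon> + on_features a) in (features z, z $ None)) \<in> borel_measurable N"
proof -
  have "sets N = sets borel" using assms by (simp add: linear_scm_def)
  moreover have "continuous_on UNIV (\<lambda>\<epsilon>. let z = scm_solution A (\<epsilon> + on_features a) in (features z, z $ None))"
    unfolding Let_def
    by (intro continuous_intros linear_continuous_on_compose[OF _ linear_features]
        linear_continuous_on_compose[OF _ linear_scm_solution[OF assms]])
  ultimately show ?thesis
    using borel_measurable_continuous_onI measurable_cong_sets by blast
qed

lemma sets_law [simp]: "sets (law A N a) = sets borel"
  by (simp add: law_def)

lemma mean_features_law:
  assumes "linear_scm G A N"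
  shows "mean_features (law A N a) = mean_features (law A N 0) + effect_matrix A *v a"
proof -
  interpret prob_space N using assms by (simp add: linear_scm_def)
  have "linear (\<lambda>\<epsilon>. features (scm_solution A \<epsilon>))"
    using linear_compose[OF linear_scm_solution[OF assms] linear_features] by (simp add: o_def)
  then have int: "integrable N (\<lambda>\<epsilon>. features (scm_solution A \<epsilon>))"
    using integrable_bounded_linear[OF linear_conv_bounded_linear[THEN iffD1]
      linear_scm_integrable(2)[OF assms]] by blast
  have "(fst :: (real^'a) \<times> real \<Rightarrow> _) \<in> borel_measurable borel"
    by (intro borel_measurable_continuous_onI continuous_intros)
  then have "mean_features (law A N a) = (LINT \<epsilon>|N. features (scm_solution A \<epsilon>)) + effect_matrix A *v a" for a
    unfolding mean_features_def law_def
    by (subst integral_distr[OF borel_measurable_response[OF assms]])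
      (simp_all add: Let_def features_intervention[OF assms] int prob_space)
  from this[of a] this[of 0] show ?thesis by simp
qed

text \<open>The mean of the features reveals the intervention because the effect matrix is
  invertible. Hence the loop's membership test on laws is a test on interventions.\<close>

lemma inj_law:
  assumes "linear_scm G A N"
  shows "inj (law A N)"
proof (rule injI)
  fix a a' assume "law A N a = law A N a'"
  then have "effect_matrix A *v a = effect_matrix A *v a'"
    using mean_features_law[OF assms, of a] mean_features_law[OF assms, of a'] by simp
  then show "a = a'"
    using invertible_effect_matrix[OF assms] inj_matrix_vector_mult by (metis injD)
qed

lemma square_integrable_law:
  fixes h :: "(real^'n::finite) \<times> real \<Rightarrow> real"
  assumes "linear_scm G A N" "linear h"
  shows "integrable (law A N a) (\<lambda>p. (h p)\<^sup>2)"
proof -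
  define g where "g z = h (features z, z $ None)" for z
  have g: "linear g"
  proof -
    have "linear (\<lambda>z::real^('n option). (features z, z $ None))"
      by (rule linearI) (simp_all add: linear_add[OF linear_features] linear_scale[OF linear_features])
    from linear_compose[OF this assms(2)] show ?thesis by (simp add: g_def[abs_def] o_def)
  qed
  have lin: "linear (\<lambda>\<epsilon>. g (scm_solution A \<epsilon>))"
    using linear_compose[OF linear_scm_solution[OF assms(1)] g] by (simp add: o_def)
  \<comment> \<open>The adjoint at 1 is the vector that represents this linear functional as an
    inner product.\<close>
  define l where "l = adjoint (\<lambda>\<epsilon>. g (scm_solution A \<epsilon>)) 1"
  have l: "g (scm_solution A \<epsilon>) = l \<bullet> \<epsilon>" for \<epsilon>
    using adjoint_works[OF lin, of \<epsilon> 1] by (simp add: l_def inner_commute)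
  have "integrable N (\<lambda>\<epsilon>. (l \<bullet> \<epsilon> + l \<bullet> on_features a)\<^sup>2)"
    by (rule linear_scm_integrable(1)[OF assms(1)])
  then have "integrable N (\<lambda>\<epsilon>. (g (scm_solution A (\<epsilon> + on_features a)))\<^sup>2)"
    by (simp add: l inner_add_right)
  moreover have "(\<lambda>p. (h p)\<^sup>2) \<in> borel_measurable borel"
    using assms(2) by (intro borel_measurable_continuous_onI continuous_on_power
        linear_continuous_on[OF linear_conv_bounded_linear[THEN iffD1]])
  ultimately show ?thesis
    unfolding law_def
    by (subst integrable_distr_eq[OF borel_measurable_response[OF assms(1)]])
      (simp_all add: Let_def g_def)
qed

lemma square_integrable_norm_features_law:
  fixes A :: "real^('n::finite option)^('n option)"
  assumes "linear_scm G A N"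
  shows "integrable (law A N a) (\<lambda>p. (norm (fst p))\<^sup>2)"
proof -
  have "linear (\<lambda>p::(real^'n) \<times> real. fst p $ i)" for i
    by (rule linearI) auto
  then have "integrable (law A N a) (\<lambda>p. \<Sum>i\<in>UNIV. (fst p $ i)\<^sup>2)"
    by (intro Bochner_Integration.integrable_sum square_integrable_law[OF assms])
  then show ?thesis
    by (simp add: norm_vec_def L2_set_def sum_nonneg)
qed

section \<open>Best responses as a finite comparison\<close>

text \<open>Some single intervention is optimal within the whole budget set, so whatever beats all
  single interventions is optimal there too. This leaves finitely many linear inequalities in
  \<open>w\<close>.\<close>

lemma best_responses_iff:
  fixes A :: "real^('n::finite option)^('n option)" and c :: "'n \<Rightarrow> ennreal"
  assumes "best_responses A c b w \<noteq> {}" "\<And>i. 0 < c i" "0 < b"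
  shows "a \<in> best_responses A c b w \<longleftrightarrow> a \<in> single_interventions c b \<and>
    (\<forall>a'\<in>single_interventions c b. w \<bullet> (effect_matrix A *v a') \<le> w \<bullet> (effect_matrix A *v a))"
proof -
  \<comment> \<open>At \<open>w = 0\<close> all single interventions tie as best responses, and best
    responses are within budget.\<close>
  have feasible: "within_budget c b a'" if "a' \<in> single_interventions c b" for a'
  proof -
    have "a' \<in> best_responses A c b 0"
      using that best_responses_eq[where A = A and c = c and b = b and w = 0, OF assms(2,3)] by (auto simp: single_interventions_def)
    then show ?thesis by (simp add: best_responses_def)
  qed
  obtain m where m: "m \<in> best_responses A c b w" using assms(1) by blast
  then have "m \<in> single_interventions c b" by (simp add: best_responses_def)
  with m feasible show ?thesis
    by (fastforce simp: best_responses_def inner_add_right)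
qed

lemma axis_uminus: "axis i (- x) = - axis i (x::real)"
  by (simp add: axis_def vec_eq_iff)

lemma inner_matrix_axis:
  "w \<bullet> (B *v axis i x) = x * (w \<bullet> (B *v axis i (1::real)))"
proof -
  have "axis i x = x *\<^sub>R axis i (1::real)" by (simp add: axis_def vec_eq_iff)
  then show ?thesis by (simp add: matrix_vector_mult_scaleR)
qed

section \<open>The search loop: revealed interventions and their number\<close>

definition interventions_on :: "('n::finite \<Rightarrow> ennreal) \<Rightarrow> real \<Rightarrow> 'n set \<Rightarrow> (real^'n) set"
  where "interventions_on c b F =
    {axis i (s * (b / enn2real (c i))) | i s. i \<in> F \<and> (s = 1 \<or> s = -1)}"

lemma interventions_on_mutable: "interventions_on c b (mutable c) = single_interventions c b"
  by (simp add: interventions_on_def single_interventions_def)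

lemma interventions_on_insert:
  "interventions_on c b (insert i F) = interventions_on c b F \<union>
    {axis i (b / enn2real (c i)), - axis i (b / enn2real (c i))}"
proof -
  have "{axis i (s * (b / enn2real (c i))) | s. s = 1 \<or> s = -1} =
      {axis i (b / enn2real (c i)), - axis i (b / enn2real (c i))}"
    by (auto simp: axis_uminus intro: exI[of _ 1] exI[of _ "-1"])
  moreover have "interventions_on c b (insert i F) = interventions_on c b F \<union>
      {axis i (s * (b / enn2real (c i))) | s. s = 1 \<or> s = -1}"
    unfolding interventions_on_def by blast
  ultimately show ?thesis by simp
qed

text \<open>The nonzero entry determines the coordinate and both signs belong to the set, so only
  the feature matters.\<close>

lemma axis_mem_interventions_on:
  assumes "0 < b" "0 < c i" "i \<in> mutable c" "s = 1 \<or> s = -1"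
  shows "axis i (s * (b / enn2real (c i))) \<in> interventions_on c b F \<longleftrightarrow> i \<in> F"
proof -
  have "0 < enn2real (c i)" using assms by (simp add: mutable_def enn2real_positive_iff)
  then have "s * (b / enn2real (c i)) \<noteq> 0" using assms by auto
  then show ?thesis using assms(4) by (auto simp: interventions_on_def axis_eq_axis)
qed

text \<open>Turns the exit test \<open>card S' = 2 * k\<close> into the statement that every mutable
  feature has been revealed.\<close>

lemma card_interventions_on:
  fixes c :: "'n::finite \<Rightarrow> ennreal"
  assumes "0 < b" "\<And>i. 0 < c i" "F \<subseteq> mutable c"
  shows "card (interventions_on c b F) = 2 * card F"
  using finite[of F] assms(3)
proof (induction F)
  case empty
  then show ?case by (simp add: interventions_on_def)
next
  case (insert i F)
  let ?a = "axis i (b / enn2real (c i))"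
  have i: "i \<in> mutable c" using insert.prems by simp
  have pos: "0 < b / enn2real (c i)"
    using assms(1,2) i by (simp add: mutable_def enn2real_positive_iff)
  have "b \<noteq> 0" "enn2real (c i) \<noteq> 0" using pos by auto
  have "?a \<notin> interventions_on c b F" "- ?a \<notin> interventions_on c b F"
    using axis_mem_interventions_on[where F=F and i=i and s=1, of b c]
      axis_mem_interventions_on[where F=F and i=i and s="-1", of b c] assms(1,2) i insert.hyps(2)
    by (simp_all add: axis_uminus)
  moreover have "?a \<noteq> - ?a"
    using \<open>b \<noteq> 0\<close> \<open>enn2real (c i) \<noteq> 0\<close> by (simp add: axis_eq_axis flip: axis_uminus)
  moreover have "finite (interventions_on c b F)"
    by (rule finite_subset[of _ "(\<lambda>(i, s). axis i (s * (b / enn2real (c i)))) ` (F \<times> {1, -1})"])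
      (auto simp: interventions_on_def)
  ultimately have "card (insert ?a (insert (- ?a) (interventions_on c b F))) =
      Suc (Suc (card (interventions_on c b F)))"
    by simp
  then show ?case using insert by (simp add: interventions_on_insert insert_commute)
qed

text \<open>
  \<open>F\<close> is the set of features whose effects have been observed.  \<open>U\<close> is the set of null vectors
  that revealed nothing new; such a vector is orthogonal to the effects of all mutable features,
  so that at most \<open>CARD('n) - card (mutable c)\<close> of them occur.
\<close>

definition loop_invariant ::
  "real^('n::finite option)^('n option) \<Rightarrow> (real^('n option)) measure \<Rightarrow> ('n \<Rightarrow> ennreal) \<Rightarrow> real
    \<Rightarrow> 'n set \<Rightarrow> (real^'n) set \<Rightarrow> ((real^'n) \<times> real) measure set \<Rightarrow> (real^'n) list \<Rightarrow> bool"
  where "loop_invariant A N c b F U S W \<longleftrightarrow>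
    F \<subseteq> mutable c \<and> S = law A N ` interventions_on c b F \<and>
    null_space_transpose W = {w. (\<forall>i\<in>F. w \<bullet> (effect_matrix A *v axis i 1) = 0) \<and> (\<forall>u\<in>U. w \<bullet> u = 0)} \<and>
    finite U \<and> pairwise orthogonal U \<and> 0 \<notin> U \<and>
    (\<forall>u\<in>U. \<forall>j\<in>mutable c. u \<bullet> (effect_matrix A *v axis j 1) = 0)"

lemma dim_effects:
  assumes "linear_scm G A N"
  shows "dim ((\<lambda>j. effect_matrix A *v axis j (1::real)) ` F) = card F"
proof -
  have inj: "inj ((*v) (effect_matrix A))"
    using invertible_effect_matrix[OF assms] by (rule inj_matrix_vector_mult)
  have "inj_on (\<lambda>j::'a. axis j (1::real)) F" by (auto simp: inj_on_def axis_eq_axis)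
  moreover have "independent ((\<lambda>j::'a. axis j (1::real)) ` F)"
    by (rule independent_mono[OF independent_Basis]) (auto simp: Basis_vec_def)
  ultimately have "dim ((\<lambda>j::'a. axis j (1::real)) ` F) = card F"
    by (simp add: dim_eq_card_independent card_image)
  moreover have "dim ((*v) (effect_matrix A) ` ((\<lambda>j::'a. axis j (1::real)) ` F)) = dim ((\<lambda>j::'a. axis j (1::real)) ` F)"
    by (rule dim_image_eq) (use inj inj_on_subset in auto)
  ultimately show ?thesis by (simp add: image_image)
qed

text \<open>\<open>U\<close> is independent, being orthogonal without 0, and it is orthogonal to the
  effects of the mutable features, which are independent as columns of an invertible matrix; the
  dimensions add up.\<close>

lemma loop_invariant_card:
  fixes A :: "real^('n::finite option)^('n option)"
  assumes "linear_scm G A N" "loop_invariant A N c b F U S W"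
  shows "card (mutable c) + card U \<le> CARD('n)"
proof -
  have "independent U" "finite U"
    and orth: "\<forall>u\<in>U. \<forall>j\<in>mutable c. u \<bullet> (effect_matrix A *v axis j 1) = 0"
    using assms(2) by (auto simp: loop_invariant_def pairwise_orthogonal_independent)
  then have "card (mutable c) + card U = dim ((\<lambda>j. effect_matrix A *v axis j (1::real)) ` mutable c) + dim U"
    by (simp add: dim_effects[OF assms(1)] dim_eq_card_independent)
  also have "\<dots> = dim ((\<lambda>j. effect_matrix A *v axis j (1::real)) ` mutable c \<union> U)"
    using orth by (intro dim_orthogonal_sum[symmetric]) (auto simp: inner_commute)
  also have "\<dots> \<le> CARD('n)" using dim_subset_UNIV[of "_ :: (real^'n) set"] by simp
  finally show ?thesis .
qed

text \<open>Fewer than \<open>CARD('n)\<close> vectors cannot span the space. This supplies the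
  condition under which \<open>null_vec\<close> is guaranteed to return a nonzero null
  vector.\<close>

lemma loop_invariant_null_vector:
  fixes A :: "real^('n::finite option)^('n option)"
  assumes "linear_scm G A N" "loop_invariant A N c b F U S W" "card F + card U < CARD('n)"
  shows "\<exists>w\<in>null_space_transpose W. w \<noteq> 0"
proof -
  let ?E = "(\<lambda>j. effect_matrix A *v axis j (1::real)) ` F"
  have "finite U" using assms(2) by (simp add: loop_invariant_def)
  then have "dim (?E \<union> U) \<le> card (?E \<union> U)" by (intro dim_le_card') simp
  also have "\<dots> \<le> card F + card U"
    by (rule order_trans[OF card_Un_le]) (simp add: card_image_le)
  finally have "dim (?E \<union> U) < DIM(real^'n)" using assms(3) by simp
  then obtain x where x: "x \<noteq> 0" "\<And>y. y \<in> span (?E \<union> U) \<Longrightarrow> orthogonal x y"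
    by (rule orthogonal_to_subspace_exists) blast
  have "x \<bullet> y = 0" if "y \<in> ?E \<union> U" for y
    using x(2)[OF span_base[OF that]] by (simp add: orthogonal_def)
  then have "x \<in> null_space_transpose W" using assms(2) by (simp add: loop_invariant_def)
  with x(1) show ?thesis by blast
qed

lemma null_space_transpose_append:
  "null_space_transpose (W @ [v]) = {w \<in> null_space_transpose W. v \<bullet> w = 0}"
  by (auto simp: null_space_transpose_def)

text \<open>Each iteration enlarges exactly one of \<open>F\<close> and \<open>U\<close> by one
  element, so \<open>card F + card U + m\<close> stays constant, and it costs two
  deployments.\<close>

lemma lo_loop_correct:
  fixes A :: "real^('n::finite option)^('n option)"
  assumes scm: "linear_scm G A N" and c: "\<And>i. 0 < c i" and b: "0 < b"
    and rule: "response_rule A c b respond" and null: "null_vector_routine null_vec"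
    and inv: "loop_invariant A N c b F U S W" and card: "card F + card U + m = CARD('n)"
  shows "fst (lo_loop (\<lambda>w. law A N (respond w)) null_vec (card (mutable c))
        (mean_features (law A N 0)) m (S, W, deployed)) = law A N ` single_interventions c b \<and>
    length (snd (snd (lo_loop (\<lambda>w. law A N (respond w)) null_vec (card (mutable c))
        (mean_features (law A N 0)) m (S, W, deployed)))) \<le> length deployed + 2 * m"
  using inv card
proof (induction m arbitrary: F U S W deployed)
  case 0
  \<comment> \<open>When the counter runs out, \<open>card F + card U\<close> is the full dimension,
    while \<open>card U\<close> leaves room for all mutable features; hence none is missing.\<close>
  then have "card (mutable c) \<le> card F" using loop_invariant_card[OF scm 0(1)] by simp
  moreover have "F \<subseteq> mutable c" "S = law A N ` interventions_on c b F"
    using 0(1) by (simp_all add: loop_invariant_def)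
  ultimately have "F = mutable c" by (simp add: card_seteq)
  then show ?case using 0(1) by (simp add: loop_invariant_def interventions_on_mutable)
next
  case (Suc m)
  let ?B = "effect_matrix A"
  define w where "w = null_vec W"
  have "\<exists>w\<in>null_space_transpose W. w \<noteq> 0"
    using Suc.prems by (intro loop_invariant_null_vector[OF scm]) auto
  then have w: "w \<in> null_space_transpose W" "w \<noteq> 0"
    using null by (auto simp: w_def null_vector_routine_def)
  have F: "F \<subseteq> mutable c" and S: "S = law A N ` interventions_on c b F"
    and W: "null_space_transpose W = {w. (\<forall>i\<in>F. w \<bullet> (?B *v axis i 1) = 0) \<and> (\<forall>u\<in>U. w \<bullet> u = 0)}"
    and U: "finite U" "pairwise orthogonal U" "0 \<notin> U"
      "\<forall>u\<in>U. \<forall>j\<in>mutable c. u \<bullet> (?B *v axis j 1) = 0"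
    using Suc.prems(1) by (simp_all add: loop_invariant_def)
  have best: "respond w \<in> best_responses A c b w" using rule by (simp add: response_rule_def)
  then have opt: "respond w \<in> single_interventions c b"
      "\<And>a'. a' \<in> single_interventions c b \<Longrightarrow> w \<bullet> (?B *v a') \<le> w \<bullet> (?B *v respond w)"
    using best_responses_iff[where A = A and c = c and w = w, OF _ c b] by blast+
  obtain i s where i: "i \<in> mutable c" and s: "s = 1 \<or> s = -1"
    and a: "respond w = axis i (s * (b / enn2real (c i)))"
    using opt(1) by (auto simp: single_interventions_def)
  have cpos: "0 < enn2real (c j)" if "j \<in> mutable c" for j
    using that c[of j] by (simp add: mutable_def enn2real_positive_iff)
  have mem: "law A N (respond w) \<in> S \<longleftrightarrow> i \<in> F"
    unfolding S inj_image_mem_iff[OF inj_law[OF scm]] a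
    by (rule axis_mem_interventions_on[OF b c i s])
  show ?case
  proof (cases "i \<in> F")
    case True
    \<comment> \<open>The null vector \<open>w\<close> is orthogonal to the known effect, so the
      best achievable gain is 0. Applied to both signs on each mutable feature, this forces
      \<open>w\<close> to be orthogonal to all their effects.\<close>
    have "w \<bullet> (?B *v respond w) = 0"
      unfolding a inner_matrix_axis[of w ?B i "s * (b / enn2real (c i))"] using w(1) W True by simp
    have le: "w \<bullet> (?B *v axis j (t * (b / enn2real (c j)))) \<le> 0"
      if "j \<in> mutable c" "t = 1 \<or> t = -1" for j t
    proof -
      have "axis j (t * (b / enn2real (c j))) \<in> single_interventions c b"
        using that unfolding single_interventions_def by blast
      from opt(2)[OF this] show ?thesis using \<open>w \<bullet> (?B *v respond w) = 0\<close> by simp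
    qed
    have orth: "w \<bullet> (?B *v axis j 1) = 0" if j: "j \<in> mutable c" for j
    proof -
      have "(b / enn2real (c j)) * (w \<bullet> (?B *v axis j 1)) = 0"
        using le[OF j, of 1] le[OF j, of "-1"]
        unfolding inner_matrix_axis[of w ?B j "_ * _"] by simp
      then show ?thesis using b cpos[OF j] by simp
    qed
    have wU: "\<forall>u\<in>U. w \<bullet> u = 0" using w(1) W by simp
    then have "w \<notin> U" using w(2) by auto
    have "loop_invariant A N c b F (insert w U) S (W @ [w])"
      unfolding loop_invariant_def
      using F S W U w(2) orth wU unfolding null_space_transpose_append pairwise_insert orthogonal_def
      by (auto simp: inner_commute)
    from Suc.IH[OF this, of "deployed @ [w, - w]"] show ?thesis
      using mem True Suc.prems(2) \<open>w \<notin> U\<close> U(1) by (simp add: w_def[symmetric] Let_def)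
  next
    case False
    let ?S = "S \<union> {law A N (respond w), law A N (respond (- w))}"
    let ?W = "W @ [mean_features (law A N (respond w)) - mean_features (law A N 0)]"
    have neg: "respond (- w) = - respond w" using rule w(2) by (simp add: response_rule_def)
    \<comment> \<open>Opposite mechanisms reveal both signs on feature \<open>i\<close>, whichever
      sign came first.\<close>
    have "{respond w, respond (- w)} = {axis i (b / enn2real (c i)), - axis i (b / enn2real (c i))}"
      using s by (auto simp: neg a axis_uminus)
    then have S': "?S = law A N ` interventions_on c b (insert i F)"
      unfolding S interventions_on_insert image_Un by (metis image_insert image_empty)
    \<comment> \<open>The appended column is a nonzero multiple of the effect of \<open>i\<close>,
      so both cut out the same null space.\<close>
    have "(?B *v respond w) \<bullet> v = 0 \<longleftrightarrow> v \<bullet> (?B *v axis i 1) = 0" for v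
      unfolding a inner_commute[of _ v] inner_matrix_axis[of v ?B i "s * (b / enn2real (c i))"]
      using s b cpos[OF i] by auto
    moreover have "mean_features (law A N (respond w)) - mean_features (law A N 0) = ?B *v respond w"
      using mean_features_law[OF scm, of "respond w"] by simp
    ultimately have "null_space_transpose ?W =
        {w. (\<forall>j\<in>insert i F. w \<bullet> (?B *v axis j 1) = 0) \<and> (\<forall>u\<in>U. w \<bullet> u = 0)}"
      unfolding null_space_transpose_append W by auto
    then have inv': "loop_invariant A N c b (insert i F) U ?S ?W"
      unfolding loop_invariant_def using F i S' U by blast
    have F': "insert i F \<subseteq> mutable c" using F i by simp
    have "card ?S = 2 * card (insert i F)"
      unfolding S' by (simp add: card_image inj_on_subset[OF inj_law[OF scm]] card_interventions_on[OF b c F'])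
    then have full: "card ?S = 2 * card (mutable c) \<longleftrightarrow> insert i F = mutable c"
      using F' by (metis card_subset_eq finite mult_left_cancel zero_neq_numeral)
    show ?thesis
    proof (cases "insert i F = mutable c")
      case True
      then have "?S = law A N ` single_interventions c b"
        using S' by (simp add: interventions_on_mutable)
      then show ?thesis using mem False full True
        by (simp add: w_def[symmetric] Let_def)
    next
      case nf: False
      have "card (insert i F) + card U + m = CARD('n)" using Suc.prems(2) False by simp
      from Suc.IH[OF inv' this, of "deployed @ [w, - w]"] show ?thesis
        using mem False full nf by (simp add: w_def[symmetric] Let_def)
    qed
  qed
qed

section \<open>Values of the quadratic programs\<close>

text \<open>Differences of means are the shifts produced by interventions, so the constraints
  describe exactly the cone of mechanisms that have \<open>a\<close> among their best responses.
  Least squares attains its minimum on this cone.\<close>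

lemma qp_value_eq:
  fixes A :: "real^('n::finite option)^('n option)"
  assumes scm: "linear_scm G A N" and c: "\<And>i. 0 < c i" and b: "0 < b"
    and nonempty: "\<And>w. best_responses A c b w \<noteq> {}"
    and a: "a \<in> single_interventions c b"
  obtains w where "a \<in> best_responses A c b w"
    "qp_value (mean_features (law A N 0)) (law A N ` single_interventions c b) (law A N a) =
      risk (law A N a) w"
    "\<And>w'. a \<in> best_responses A c b w' \<Longrightarrow> risk (law A N a) w \<le> risk (law A N a) w'"
proof -
  let ?I = "single_interventions c b" and ?B = "effect_matrix A"
  define K where "K = {w. a \<in> best_responses A c b w}"
  have K: "K = {w. \<forall>a'\<in>?I. w \<bullet> (?B *v a') \<le> w \<bullet> (?B *v a)}"
    using best_responses_iff[where A = A and c = c and b = b, OF nonempty c b] a by (auto simp: K_def)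
  have "?I = (\<lambda>(i, s). axis i (s * (b / enn2real (c i)))) ` (mutable c \<times> {1, -1})"
    by (auto simp: single_interventions_def image_iff)
  then have "finite ?I" by simp
  have "K = \<Inter> ((\<lambda>a'. {w. (?B *v a' - ?B *v a) \<bullet> w \<le> 0}) ` ?I)"
    by (auto simp: K inner_commute[of "_ - _"] inner_diff_right)
  then have "polyhedron K"
    using \<open>finite ?I\<close> by (auto intro!: polyhedron_Inter polyhedron_halfspace_le)
  have "conic K" by (auto simp: conic_def K intro: mult_left_mono)
  have "0 \<in> K" by (simp add: K)
  have [measurable]: "fst \<in> borel_measurable (law A N a)" "snd \<in> borel_measurable (law A N a)"
    by (auto simp: measurable_cong_sets[OF sets_law refl]
        intro!: borel_measurable_continuous_onI continuous_intros)
  have "integrable (law A N a) (\<lambda>p. (snd p)\<^sup>2)"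
    by (intro square_integrable_law[OF scm] linear_snd)
  then obtain w where w: "w \<in> K" "\<And>w'. w' \<in> K \<Longrightarrow> risk (law A N a) w \<le> risk (law A N a) w'"
    using least_squares_attained[of fst "law A N a" snd K] square_integrable_norm_features_law[OF scm]
      \<open>polyhedron K\<close> \<open>conic K\<close> \<open>0 \<in> K\<close> unfolding risk_def by auto
  have shift: "mean_features (law A N x) - mean_features (law A N 0) = ?B *v x" for x
    using mean_features_law[OF scm, of x] by simp
  \<comment> \<open>Leaving out \<open>D\<close> itself drops only a trivial inequality.\<close>
  have all_le: "(\<forall>D'\<in>S - {D}. w \<bullet> g D' \<le> w \<bullet> g D) \<longleftrightarrow> (\<forall>D'\<in>S. w \<bullet> g D' \<le> w \<bullet> g D)"
    for w :: "real^'n" and g S and D :: "((real^'n) \<times> real) measure"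
    by auto
  have "{w. \<forall>D'\<in>law A N ` ?I - {law A N a}.
      w \<bullet> (mean_features D' - mean_features (law A N 0)) \<le>
      w \<bullet> (mean_features (law A N a) - mean_features (law A N 0))} = K"
    unfolding K all_le[where g = "\<lambda>D. mean_features D - mean_features (law A N 0)"]
    by (simp add: shift)
  then have "qp_value (mean_features (law A N 0)) (law A N ` ?I) (law A N a) = risk (law A N a) w"
    unfolding qp_value_def using w by (auto intro!: cInf_eq_minimum)
  with w show thesis by (intro that[of w]) (simp_all add: K_def)
qed

section \<open>Dominance and the recorded pairs\<close>

lemma nondominated_image_shift:
  "(\<lambda>(y, r). (y - d, r)) ` nondominated P = nondominated ((\<lambda>(y, r). (y - d, r)) ` P)"
proof -
  define h where "h = (\<lambda>(y, r). (y - d, r :: real))"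
  have "dominates (h q) (h p) \<longleftrightarrow> dominates q p" for p q
    by (cases p; cases q) (simp add: h_def dominates_def)
  then have "h ` nondominated P = nondominated (h ` P)"
    unfolding nondominated_def by blast
  then show ?thesis by (simp add: h_def)
qed

text \<open>A point of \<open>Q\<close> outside \<open>P\<close> is dominated, and by transitivity a
  point dominated from \<open>Q\<close> is already dominated from \<open>P\<close>.\<close>

lemma nondominated_subset_eqI:
  assumes "P \<subseteq> Q" "\<And>q. q \<in> Q \<Longrightarrow> \<exists>p\<in>P. p = q \<or> dominates p q"
  shows "nondominated P = nondominated Q"
proof -
  have trans: "dominates p r" if "dominates p q" "dominates q r" for p q r
    using that by (auto simp: dominates_def prod_eq_iff)
  show ?thesis
    unfolding nondominated_def using assms trans by blast
qed

theorem theorem4: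
  fixes G :: "('n::finite option) rel"
    and A :: "real^('n option)^('n option)"
    and N :: "(real^('n option)) measure"
    and c :: "'n \<Rightarrow> ennreal"
    and b :: real
    and respond :: "real^'n \<Rightarrow> real^'n"
    and null_vec :: "(real^'n) list \<Rightarrow> real^'n"
    and first :: 'n
  assumes "linear_scm G A N"
    and "\<And>i. 0 < c i"
    and "0 < b"
    and "response_rule A c b respond"
    and "null_vector_routine null_vec"
  shows "let (output, deployed) = linear_optimization (\<lambda>w. law A N (respond w)) null_vec
               (card (mutable c)) first
         in (\<lambda>(y, r). (y - mean_outcome (law A N 0), r)) ` output = pareto_frontier A N c b \<and>
            length deployed \<le> 2 * CARD('n)"
proof -
  let ?L = "law A N" and ?B = "effect_matrix A" and ?I = "single_interventions c b"
  define e where "e = axis first (1::real)"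
  define \<mu> where "\<mu> = mean_features (?L 0)"
  have nonempty: "best_responses A c b w \<noteq> {}" for w
    using assms(4) unfolding response_rule_def by blast
  have neg: "respond (- e) = - respond e"
    using assms(4) by (simp add: response_rule_def e_def axis_eq_0_iff)
  \<comment> \<open>Opposite responses shift the mean by opposite amounts, so the shifts cancel in
    the average.\<close>
  have \<mu>: "(1/2) *\<^sub>R (mean_features (?L (respond e)) + mean_features (?L (respond (- e)))) = \<mu>"
    using mean_features_law[OF assms(1), of "respond e"]
      mean_features_law[OF assms(1), of "- respond e"]
    by (simp add: neg \<mu>_def linear_neg[OF matrix_vector_mul_linear] flip: scaleR_2)
  have diff: "mean_features (?L (respond e)) - mean_features (?L (respond (- e))) =
      2 *\<^sub>R (?B *v respond e)"
    using mean_features_law[OF assms(1), of "respond e"]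
      mean_features_law[OF assms(1), of "- respond e"]
    by (simp add: neg linear_neg[OF matrix_vector_mul_linear] scaleR_2)
  have "respond e \<in> ?I" using assms(4) by (simp add: response_rule_def best_responses_def)
  then obtain i s where i: "i \<in> mutable c" and s: "s = 1 \<or> s = -1"
    and a: "respond e = axis i (s * (b / enn2real (c i)))"
    by (auto simp: single_interventions_def)
  have "enn2real (c i) > 0" using i assms(2)[of i] by (simp add: mutable_def enn2real_positive_iff)
  then have "(?B *v respond e) \<bullet> v = 0 \<longleftrightarrow> v \<bullet> (?B *v axis i 1) = 0" for v
    unfolding a inner_commute[of _ v] inner_matrix_axis[of v ?B i "s * (b / enn2real (c i))"]
    using s assms(3) by auto
  then have W: "null_space_transpose [2 *\<^sub>R (?B *v respond e)] = {w. w \<bullet> (?B *v axis i 1) = 0}"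
    by (simp add: null_space_transpose_def)
  have "{respond e, respond (- e)} = interventions_on c b {i}"
    using s by (auto simp: interventions_on_insert neg a axis_uminus interventions_on_def[of c b "{}"])
  then have S: "{?L (respond e), ?L (respond (- e))} = ?L ` interventions_on c b {i}"
    by (metis image_insert image_empty)
  have inv: "loop_invariant A N c b {i} {} {?L (respond e), ?L (respond (- e))}
      [2 *\<^sub>R (?B *v respond e)]"
    unfolding loop_invariant_def using i S W by simp
  obtain S' W' deployed where loop: "lo_loop (\<lambda>w. ?L (respond w)) null_vec (card (mutable c)) \<mu>
      (CARD('n) - 1) ({?L (respond e), ?L (respond (- e))}, [2 *\<^sub>R (?B *v respond e)], [e, - e]) =
      (S', W', deployed)"
    by (metis prod_cases3)
  \<comment> \<open>The initial pair already reveals one feature, so \<open>CARD('n) - 1\<close>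
    iterations remain and the total is 2 + 2(n - 1) = 2n deployments.\<close>
  have "card {i} + card ({} :: (real^'n) set) + (CARD('n) - 1) = CARD('n)"
    using zero_less_card_finite[where 'a = 'n] by simp
  from lo_loop_correct[OF assms inv this, where deployed = "[e, - e]"]
  have S': "S' = ?L ` ?I" and "length deployed \<le> 2 + 2 * (CARD('n) - 1)"
    unfolding \<mu>_def[symmetric] loop by simp_all
  then have len: "length deployed \<le> 2 * CARD('n)"
    using zero_less_card_finite[where 'a = 'n] by linarith
  define P where "P = {(mean_outcome (?L a), qp_value \<mu> (?L ` ?I) (?L a)) | a. a \<in> ?I}"
  have "linear_optimization (\<lambda>w. ?L (respond w)) null_vec (card (mutable c)) first =
      (nondominated {(mean_outcome D, qp_value \<mu> (?L ` ?I) D) | D. D \<in> ?L ` ?I}, deployed)"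
    unfolding linear_optimization_def Let_def e_def[symmetric] \<mu> diff loop S' prod.case ..
  also have "{(mean_outcome D, qp_value \<mu> (?L ` ?I) D) | D. D \<in> ?L ` ?I} = P"
    unfolding P_def by blast
  finally have out: "linear_optimization (\<lambda>w. ?L (respond w)) null_vec (card (mutable c)) first =
      (nondominated P, deployed)" .
  let ?shift = "\<lambda>(y, r). (y - mean_outcome (?L 0), r :: real)"
  \<comment> \<open>Recorded pairs are attainable because each program attains its minimum. An
    attainable pair has the same improvement as the recorded pair of its response and at least its
    risk.\<close>
  have "nondominated (?shift ` P) = nondominated (attainable A N c b)"
  proof (rule nondominated_subset_eqI)
    show "?shift ` P \<subseteq> attainable A N c b"
    proof clarify
      fix y r assume "(y, r) \<in> P"
      then obtain a where a: "a \<in> ?I" "y = mean_outcome (?L a)" "r = qp_value \<mu> (?L ` ?I) (?L a)"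
        by (auto simp: P_def)
      then obtain w where "a \<in> best_responses A c b w" "r = risk (?L a) w"
        using qp_value_eq[OF assms(1-3) nonempty a(1)] by (auto simp: \<mu>_def)
      then show "(y - mean_outcome (?L 0), r) \<in> attainable A N c b"
        using a(2) by (auto simp: attainable_def)
    qed
  next
    fix q assume "q \<in> attainable A N c b"
    then obtain w a where q: "q = (mean_outcome (?L a) - mean_outcome (?L 0), risk (?L a) w)"
      and a: "a \<in> best_responses A c b w" by (auto simp: attainable_def)
    from a have I: "a \<in> ?I" by (simp add: best_responses_def)
    obtain w0 where "qp_value \<mu> (?L ` ?I) (?L a) = risk (?L a) w0"
      "\<And>w'. a \<in> best_responses A c b w' \<Longrightarrow> risk (?L a) w0 \<le> risk (?L a) w'"
      using qp_value_eq[OF assms(1-3) nonempty I] unfolding \<mu>_def by blast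
    with a have "qp_value \<mu> (?L ` ?I) (?L a) \<le> risk (?L a) w" by simp
    moreover have "?shift (mean_outcome (?L a), qp_value \<mu> (?L ` ?I) (?L a)) \<in> ?shift ` P"
      using I unfolding P_def by blast
    ultimately show "\<exists>p\<in>?shift ` P. p = q \<or> dominates p q"
      by (intro bexI[of _ "?shift (mean_outcome (?L a), qp_value \<mu> (?L ` ?I) (?L a))"])
        (auto simp: q dominates_def)
  qed
  then show ?thesis
    using len by (simp add: out nondominated_image_shift pareto_frontier_def)
qed

end
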